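(* According to relative interval analysis, $l(\mathrm{Maj},\mathrm{Eag})=[-\frac12,1]$, i.e., $\mathrm{Min}(\mathrm{Maj},\mathrm{Eag})=-\frac12$ and $\mathrm{Max}(\mathrm{Maj},\mathrm{Eag})=1$.
   Context: Online frequent items problem: an input sequence is $I=a_1,\ldots,a_n$ of items from an infinite universe, $n=|I|$. An algorithm maintains a buffer holding one item; $s_t$ is the buffer content after step $t$; at step $1$ the buffer receives $a_1$, and at each later step $t$ the algorithm either keeps $s_{t-1}$ or replaces it by $a_t$. With $f_I(a)=|\{i:a_i=a\}|/n$, the aggregate frequency of $\mathcal A$ on $I$ is $\mathcal A(I)=\sum_{t=1}^n f_I(s^{\mathcal A}_t)$. Maj keeps a counter, initially $0$: when an item arrives, if the counter is $0$ it buffers the item and sets the counter to $1$; otherwise, if the arriving item equals the buffered item the counter is incremented, else it is decremented (buffer unchanged). Eag: let $t^*=\min\{t\in\{1,\ldots,n-1\}: a_t=a_{t+1}\}$ if such $t$ exists, else $t^*=n$; Eag sets $s_t=a_t$ for $t\le t^*$ and $s_t=a_{t^*}$ for $t>t^*$. Relative interval analysis: $\mathrm{Min}_{\mathcal A,\mathcal B}(n)=\min_{|I|=n}\{\mathcal A(I)-\mathcal B(I)\}$, $\mathrm{Max}_{\mathcal A,\mathcal B}(n)=\max_{|I|=n}\{\mathcal A(I)-\mathcal B(I)\}$, $\mathrm{Min}(\mathcal A,\mathcal B)=\liminf_{n\to\infty}\mathrm{Min}_{\mathcal A,\mathcal B}(n)/n$, $\mathrm{Max}(\mathcal A,\mathcal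 B)=\limsup_{n\to\infty}\mathrm{Max}_{\mathcal A,\mathcal B}(n)/n$, and $l(\mathcal A,\mathcal B)=[\mathrm{Min}(\mathcal A,\mathcal B),\mathrm{Max}(\mathcal A,\mathcal B)]$. *)

theory Defs
  imports "HOL-Analysis.Analysis"
begin

text \<open>
  An input sequence is a list; its items are numbered from 1 as \<open>a\<^sub>1, \<dots>, a\<^sub>n\<close>, while list
  indices start at 0. An algorithm maps an input \<open>I\<close> and a step \<open>t\<close> to the buffer content \<open>s\<^sub>t\<close>;
  only the steps \<open>1 \<le> t \<le> length I\<close> are meaningful.
\<close>

type_synonym 'a algorithm = "'a list \<Rightarrow> nat \<Rightarrow> 'a"

definition item :: "'a list \<Rightarrow> nat \<Rightarrow> 'a" where
  "item I t = I ! (t - 1)"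

text \<open>
  The first condition says that \<open>s\<^sub>t\<close> depends only on the items that have arrived by step \<open>t\<close>.
\<close>

definition online :: "'a algorithm \<Rightarrow> bool" where
  "online A \<longleftrightarrow>
     (\<forall>I J t. 1 \<le> t \<and> t \<le> length I \<and> t \<le> length J \<and> take t I = take t J \<longrightarrow> A I t = A J t) \<and>
     (\<forall>I. I \<noteq> [] \<longrightarrow> A I 1 = item I 1) \<and>
     (\<forall>I t. 2 \<le> t \<and> t \<le> length I \<longrightarrow> A I t = A I (t - 1) \<or> A I t = item I t)"

definition freq :: "'a list \<Rightarrow> 'a \<Rightarrow> real" where
  "freq I a = real (card {i \<in> {1..length I}. item I i = a}) / real (length I)"

definition agg_freq :: "'a algorithm \<Rightarrow> 'a list \<Rightarrow> real" where
  "agg_freq A I = (\<Sum>t = 1..length I. freq I (A I t))"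


text \<open>
  The state of Maj is the pair of the buffered item and the counter. The initial buffer content
  is irrelevant, because the counter is 0 when the first item arrives.
\<close>

definition maj_step :: "'a \<times> nat \<Rightarrow> 'a \<Rightarrow> 'a \<times> nat" where
  "maj_step s x = (case s of (b, c) \<Rightarrow>
     if c = 0 then (x, 1) else if x = b then (b, c + 1) else (b, c - 1))"

primrec maj_state :: "'a list \<Rightarrow> nat \<Rightarrow> 'a \<times> nat" where
  "maj_state I 0 = (undefined, 0)"
| "maj_state I (Suc t) = maj_step (maj_state I t) (item I (Suc t))"

definition maj :: "'a algorithm" where
  "maj I t = fst (maj_state I t)"

definition eag_stop :: "'a list \<Rightarrow> nat" where
  "eag_stop I =
     (if \<exists>t. 1 \<le> t \<and> t < length I \<and> item I t = item I (t + 1)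
      then LEAST t. 1 \<le> t \<and> t < length I \<and> item I t = item I (t + 1)
      else length I)"

definition eag :: "'a algorithm" where
  "eag I t = (if t \<le> eag_stop I then item I t else item I (eag_stop I))"

lemma online_maj: "online maj"
proof -
  have state: "maj_state I t = maj_state J t"
    if "t \<le> length I" "t \<le> length J" "take t I = take t J" for I J :: "'a list" and t
    using that
  proof (induction t)
    case (Suc t)
    have "take t I = take t J"
      using arg_cong[OF Suc.prems(3), of "take t"] by simp
    then have IH: "maj_state I t = maj_state J t"
      using Suc.prems by (intro Suc.IH) simp_all
    have "I ! t = J ! t"
      using arg_cong[OF Suc.prems(3), of "\<lambda>xs. xs ! t"] by simp
    with IH show ?case by (simp add: item_def)
  qed simp
  have first: "maj I 1 = item I 1" for I :: "'a list"
    by (simp add: maj_def maj_step_def)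
  have step: "maj I t = maj I (t - 1) \<or> maj I t = item I t" if "2 \<le> t" for I :: "'a list" and t
  proof -
    obtain u where "t = Suc u" using \<open>2 \<le> t\<close> by (cases t) auto
    then show ?thesis by (simp add: maj_def maj_step_def split: prod.split)
  qed
  show ?thesis
    unfolding online_def
  proof (intro conjI allI impI; (elim conjE)?)
    fix I J :: "'a list" and t
    assume "t \<le> length I" "t \<le> length J" "take t I = take t J"
    then show "maj I t = maj J t" unfolding maj_def by (rule arg_cong[OF state])
  qed (rule first, rule step)
qed

lemma le_eag_stop_iff:
  assumes "t \<le> length I"
  shows "t \<le> eag_stop I \<longleftrightarrow> (\<forall>u. 1 \<le> u \<and> u < t \<longrightarrow> item I u \<noteq> item I (u + 1))"
proof -
  define P where "P u \<longleftrightarrow> 1 \<le> u \<and> u < length I \<and> item I u = item I (u + 1)" for u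
  have stop: "eag_stop I = (if \<exists>u. P u then LEAST u. P u else length I)"
    by (simp only: eag_stop_def P_def)
  have "t \<le> eag_stop I \<longleftrightarrow> (\<forall>u<t. \<not> P u)"
  proof (cases "\<exists>u. P u")
    case True
    then have "P (LEAST u. P u)" by (rule LeastI_ex)
    moreover have "\<not> P u" if "u < (LEAST u. P u)" for u
      using that by (rule not_less_Least)
    ultimately have "t \<le> (LEAST u. P u) \<longleftrightarrow> (\<forall>u<t. \<not> P u)"
      by (meson not_le order_less_le_trans)
    with True show ?thesis by (simp add: stop)
  next
    case False
    with assms show ?thesis by (simp add: stop)
  qed
  also have "\<dots> \<longleftrightarrow> (\<forall>u. 1 \<le> u \<and> u < t \<longrightarrow> item I u \<noteq> item I (u + 1))"
  proof -
    have "u < length I" if "u < t" for u using that assms by simp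
    then show ?thesis unfolding P_def by blast
  qed
  finally show ?thesis .
qed

lemma eag_Suc:
  assumes "1 \<le> t" "t < length I"
  shows "eag I (Suc t) = (if Suc t \<le> eag_stop I then item I (Suc t) else eag I t)"
proof (cases "Suc t \<le> eag_stop I")
  case False
  then consider "eag_stop I = t" | "\<not> t \<le> eag_stop I" by linarith
  then show ?thesis by cases (simp_all add: eag_def)
qed (simp add: eag_def)

lemma online_eag: "online eag"
proof -
  have item_eq: "item I u = item J u"
    if "take t I = take t J" "1 \<le> u" "u \<le> t" for I J :: "'a list" and t u
    using that nth_take[of "u - 1" t I] nth_take[of "u - 1" t J] by (simp add: item_def)
  have pref: "eag I t = eag J t"
    if "1 \<le> t" "t \<le> length I" "t \<le> length J" "take t I = take t J" for I J :: "'a list" and t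
    using that
  proof (induction t rule: dec_induct)
    case base
    have "1 \<le> eag_stop I" "1 \<le> eag_stop J"
      using base by (auto simp: le_eag_stop_iff)
    then show ?case using base item_eq[of 1 I J 1] by (simp add: eag_def)
  next
    case (step t)
    have "take t I = take t J" using arg_cong[OF step.prems(3), of "take t"] by simp
    then have IH: "eag I t = eag J t" using step by simp
    have "item I u = item J u" if "1 \<le> u" "u \<le> Suc t" for u
      using item_eq[OF step.prems(3)] that by simp
    then have "Suc t \<le> eag_stop I \<longleftrightarrow> Suc t \<le> eag_stop J"
      using step.prems by (simp add: le_eag_stop_iff less_Suc_eq_le)
    then show ?case using IH step item_eq[OF step.prems(3)] by (simp add: eag_Suc)
  qed
  have "eag I 1 = item I 1" if "I \<noteq> []" for I :: "'a list"
  proof -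
    have "1 \<le> length I" using that by (simp add: Suc_le_eq)
    then have "1 \<le> eag_stop I" by (simp add: le_eag_stop_iff)
    then show ?thesis by (simp add: eag_def)
  qed
  moreover have "eag I t = eag I (t - 1) \<or> eag I t = item I t" if "2 \<le> t" "t \<le> length I"
    for I :: "'a list" and t
    using that eag_Suc[of "t - 1" I] by auto
  ultimately show ?thesis unfolding online_def using pref by blast
qed


definition diff_values :: "'a algorithm \<Rightarrow> 'a algorithm \<Rightarrow> nat \<Rightarrow> real set" where
  "diff_values A B n = {agg_freq A I - agg_freq B I | I. length I = n}"

definition Min_at :: "'a algorithm \<Rightarrow> 'a algorithm \<Rightarrow> nat \<Rightarrow> real" where
  "Min_at A B n = Min (diff_values A B n)"

definition Max_at :: "'a algorithm \<Rightarrow> 'a algorithm \<Rightarrow> nat \<Rightarrow> real" where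
  "Max_at A B n = Max (diff_values A B n)"

text \<open>
  Although there are infinitely many inputs of length \<open>n\<close>, their aggregate frequencies are integer
  multiples of \<open>1 / n\<close> between 0 and \<open>n\<close>, so the minimum and the maximum exist.
\<close>

lemma diff_values_nonempty: "diff_values A B n \<noteq> {}"
  unfolding diff_values_def using Ex_list_of_length by blast

lemma finite_diff_values: "finite (diff_values A B n)"
proof -
  let ?V = "(\<lambda>k. real k / real n) ` {..n * n}"
  have V: "agg_freq A I \<in> ?V" if "length I = n" for A :: "'a algorithm" and I
  proof -
    let ?c = "\<lambda>t. card {i \<in> {1..n}. item I i = A I t}"
    have "?c t \<le> n" for t
    proof -
      have "?c t \<le> card {1..n}" by (rule card_mono) auto
      then show ?thesis by simp
    qed
    then have "(\<Sum>t = 1..n. ?c t) \<le> n * n"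
      using sum_bounded_above[of "{1..n}" ?c n] by simp
    moreover have "agg_freq A I = real (\<Sum>t = 1..n. ?c t) / real n"
      using that by (simp add: agg_freq_def freq_def sum_divide_distrib)
    ultimately show ?thesis by blast
  qed
  have "diff_values A B n \<subseteq> (\<lambda>(x, y). x - y) ` (?V \<times> ?V)"
    unfolding diff_values_def using V by fast
  then show ?thesis by (rule finite_subset) simp
qed

text \<open>
  The limits are taken in the extended reals, where they always exist.
\<close>

definition Min_rel :: "'a algorithm \<Rightarrow> 'a algorithm \<Rightarrow> ereal" where
  "Min_rel A B = liminf (\<lambda>n. ereal (Min_at A B n / real n))"

definition Max_rel :: "'a algorithm \<Rightarrow> 'a algorithm \<Rightarrow> ereal" where
  "Max_rel A B = limsup (\<lambda>n. ereal (Max_at A B n / real n))"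

definition rel_interval :: "'a algorithm \<Rightarrow> 'a algorithm \<Rightarrow> real set" where
  "rel_interval A B = {x. Min_rel A B \<le> ereal x \<and> ereal x \<le> Max_rel A B}"

end

theory Submission
  imports Defs
begin

text \<open>
  Let \<open>a\<close> be a most frequent item of an input of length \<open>n\<close>, with frequency \<open>f\<close>. Every arrival of \<open>a\<close>
  while Maj holds another item decrements a counter that an arrival of that other item had
  incremented, so Maj misses \<open>a\<close> in at most \<open>2(1 - f)n\<close> steps. No algorithm gains more than \<open>f\<close> over
  Maj in such a step, or anything in the remaining ones, so Maj loses at most \<open>2f(1 - f)n \<le> n/2\<close>
  against any algorithm. With pairwise distinct \<open>x\<^sub>i\<close>, the bound \<open>-1/2\<close> is approached on
  \<open>a, a, x\<^sub>3, x\<^sub>4, x\<^sub>5, a, x\<^sub>7, a, x\<^sub>9, a, \<dots>\<close> and the trivial bound \<open>1\<close> on \<open>b, b, a, a, a, \<dots>\<close>.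
\<close>

section \<open>Elementary facts on counts and frequencies\<close>

lemma card_Collect_atLeastAtMost_Suc:
  "card {i \<in> {1..Suc t}. P i} = card {i \<in> {1..t}. P i} + of_bool (P (Suc t))"
proof -
  have "{i \<in> {1..Suc t}. P i} =
      (if P (Suc t) then insert (Suc t) {i \<in> {1..t}. P i} else {i \<in> {1..t}. P i})"
    by (auto simp: le_Suc_eq)
  then show ?thesis by simp
qed

lemma item_map_upt:
  assumes "1 \<le> t" "t \<le> n"
  shows "item (map h [1..<Suc n]) t = h t"
  using assms by (simp add: item_def nth_append del: upt_Suc)

lemma freq_nonneg: "0 \<le> freq I a"
  by (simp add: freq_def)

lemma freq_le_one: "freq I a \<le> 1"
proof -
  have "card {i \<in> {1..length I}. item I i = a} \<le> card {1..length I}"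
    by (rule card_mono) auto
  then show ?thesis by (simp add: freq_def divide_le_eq_1)
qed

text \<open>The universe may be infinite, but the counts are natural numbers bounded by
  \<open>length I\<close>, so a largest one is attained.\<close>

lemma most_frequent_exists: "\<exists>a. \<forall>b. freq I b \<le> freq I a"
proof -
  let ?c = "\<lambda>a. card {i \<in> {1..length I}. item I i = a}"
  have "?c a \<le> card {1..length I}" for a
    by (rule card_mono) auto
  then have "\<forall>a. True \<longrightarrow> ?c a < Suc (length I)"
    by (simp add: less_Suc_eq_le)
  then obtain a where "\<forall>b. ?c b \<le> ?c a"
    using ex_has_greatest_nat[of "\<lambda>_. True" undefined ?c "Suc (length I)"] by blast
  then show ?thesis
    unfolding freq_def by (intro exI[of _ a] allI divide_right_mono) auto
qed

lemma agg_freq_nonneg: "0 \<le> agg_freq A I"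
  by (simp add: agg_freq_def sum_nonneg freq_nonneg)

lemma agg_freq_le_length: "agg_freq A I \<le> real (length I)"
  using sum_bounded_above[of "{1..length I}" "\<lambda>t. freq I (A I t)" 1]
  by (simp add: agg_freq_def freq_le_one)


section \<open>Dynamics of Maj and Eag\<close>

lemma maj_state_rec:
  assumes "1 \<le> t"
  shows "maj_state I t = maj_step (maj_state I (t - 1)) (item I t)"
  using assms by (cases t) auto

text \<open>The counter is the potential of an amortized argument: each step raises the left side by
  at most 2. While another item stays buffered, an arrival of \<open>a\<close> contributes 2 + 1 and
  lowers the counter by 1, and any other arrival contributes 1 and raises the counter by at most 1.
  If \<open>a\<close> is buffered after the step, only an arrival of \<open>a\<close> contributes,
  namely 2. Dropping the counter bounds the steps in which Maj misses \<open>a\<close>.\<close>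

lemma maj_potential:
  "2 * card {i \<in> {1..t}. item I i = a} + card {i \<in> {1..t}. maj I i \<noteq> a}
     + (if maj I t \<noteq> a then snd (maj_state I t) else 0) \<le> 2 * t"
proof (induction t)
  case (Suc t)
  obtain b c where "maj_state I t = (b, c)" by fastforce
  with Suc show ?case
    unfolding card_Collect_atLeastAtMost_Suc
    by (auto simp: maj_def maj_step_def split: if_splits)
qed simp

lemma agg_freq_diff_maj_le: "agg_freq A I - agg_freq maj I \<le> real (length I) / 2"
proof -
  let ?n = "length I"
  obtain a where a: "freq I b \<le> freq I a" for b
    using most_frequent_exists by metis
  define m where "m = card {i \<in> {1..?n}. item I i = a}"
  define d where "d = card {t \<in> {1..?n}. maj I t \<noteq> a}"
  have f: "freq I a = real m / real ?n"
    by (simp add: freq_def m_def)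
  have d: "real d \<le> 2 * (real ?n - real m)"
    using maj_potential[of ?n I a] by (simp add: m_def d_def)
  have "agg_freq A I - agg_freq maj I = (\<Sum>t = 1..?n. freq I (A I t) - freq I (maj I t))"
    by (simp add: agg_freq_def sum_subtractf)
  also have "\<dots> \<le> (\<Sum>t = 1..?n. if maj I t \<noteq> a then freq I a else 0)"
  proof (rule sum_mono)
    fix t
    show "freq I (A I t) - freq I (maj I t) \<le> (if maj I t \<noteq> a then freq I a else 0)"
      using a[of "A I t"] freq_nonneg[of I "maj I t"] by auto
  qed
  also have "\<dots> = real d * freq I a"
    by (simp add: d_def flip: sum.inter_filter)
  also have "\<dots> \<le> real ?n / 2"
  proof (cases "?n = 0")
    case False
    have "real d * real m \<le> 2 * (real ?n - real m) * real m"
      using d by (rule mult_right_mono) simp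
    \<comment> \<open>This is \<open>(?n - 2 * m)^2 \<ge> 0\<close> rearranged; equality would need
      \<open>a\<close> to fill exactly half of the input.\<close>
    also have "2 * (real ?n - real m) * real m \<le> real ?n * real ?n / 2"
      using zero_le_square[of "real ?n - 2 * real m"] by (simp add: algebra_simps)
    finally show ?thesis
      using False by (simp add: f field_simps)
  next
    case True
    \<comment> \<open>For the empty input \<open>freq I a\<close> is a division by zero, which is
      0.\<close>
    then show ?thesis by (simp only: f) simp
  qed
  finally show ?thesis .
qed

text \<open>Both extremal inputs start with a repeated item, which freezes Eag at step 1.\<close>

lemma eag_const:
  assumes "2 \<le> length I" "item I 1 = item I 2" "1 \<le> t"
  shows "eag I t = item I 1"
proof -
  have P: "1 \<le> (1::nat) \<and> 1 < length I \<and> item I 1 = item I (1 + 1)"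
    using assms by (simp add: numeral_2_eq_2)
  have "(LEAST t. 1 \<le> t \<and> t < length I \<and> item I t = item I (t + 1)) = 1"
    using P by (intro Least_equality) auto
  then have "eag_stop I = 1"
    using P unfolding eag_stop_def by metis
  then show ?thesis
    using \<open>1 \<le> t\<close> by (simp add: eag_def)
qed


section \<open>Extremal inputs\<close>

lemma diff_maj_eag_low:
  assumes "infinite (UNIV :: 'a set)" "5 \<le> n"
  shows "\<exists>I :: 'a list. length I = n \<and> agg_freq maj I - agg_freq eag I \<le> 7 - real n / 2"
proof -
  obtain g :: "nat \<Rightarrow> 'a" where g: "inj g"
    using assms(1) infinite_countable_subset by blast
  \<comment> \<open>Position 4 is exempted so that two fresh items, at 3 and 4, cancel the counter 2
    built up by the initial pair. From then on each fresh item enters Maj's buffer at an odd step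
    and the next \<open>g 0\<close> only resets the counter to 0.\<close>
  define h where "h t = (if t = 1 \<or> even t \<and> t \<noteq> 4 then g 0 else g t)" for t
  define I where "I = map h [1..<Suc n]"
  have len: "length I = n" by (simp add: I_def)
  have it: "item I t = h t" if "1 \<le> t" "t \<le> n" for t
    unfolding I_def using that by (rule item_map_upt)
  have ne: "g i = g j \<longleftrightarrow> i = j" for i j
    using g by (auto dest: injD)

  have 4: "snd (maj_state I 4) = 0"
  proof -
    have "maj_state I 1 = (g 0, 1)"
      using \<open>5 \<le> n\<close> by (simp add: maj_step_def it h_def)
    then have "maj_state I 2 = (g 0, 2)"
      using \<open>5 \<le> n\<close> by (simp add: maj_state_rec[of 2] maj_step_def it h_def)
    then have "maj_state I 3 = (g 0, 1)"
      using \<open>5 \<le> n\<close> by (simp add: maj_state_rec[of 3] maj_step_def it h_def ne)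
    then show ?thesis
      using \<open>5 \<le> n\<close> by (simp add: maj_state_rec[of 4] maj_step_def it h_def ne)
  qed
  \<comment> \<open>The even case needs \<open>t > 4\<close>: at step 4 the counter is 0, but the
    buffer still holds \<open>g 0\<close>.\<close>
  have state: "snd (maj_state I t) = (if even t then 0 else 1) \<and> (odd t \<longrightarrow> maj I t = g t)
      \<and> (even t \<and> t > 4 \<longrightarrow> maj I t = g (t - 1))"
    if "4 \<le> t" "t \<le> n" for t
    using that
  proof (induction t rule: dec_induct)
    case (step t)
    then have "item I (Suc t) = (if even t then g (Suc t) else g 0)"
      using it[of "Suc t"] by (auto simp: h_def)
    moreover obtain b c where "maj_state I t = (b, c)" by fastforce
    ultimately show ?case
      using step by (auto simp: maj_def maj_step_def ne)
  qed (simp add: 4)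
  have single: "freq I (g k) \<le> 1 / real n" if "k \<noteq> 0" for k
  proof -
    have "{i \<in> {1..n}. item I i = g k} \<subseteq> {k}"
      using that by (auto simp: it h_def ne split: if_splits)
    then have "card {i \<in> {1..n}. item I i = g k} \<le> card {k}"
      by (intro card_mono) auto
    then show ?thesis by (simp add: freq_def len divide_right_mono)
  qed
  \<comment> \<open>The first four steps are charged the trivial bound 1; in every later step Maj
    holds an item that occurs at most once. The total is 4 + 1.\<close>
  have "agg_freq maj I \<le> (\<Sum>t = 1..n. (if t \<le> 4 then 1 else 0) + 1 / real n)"
    unfolding agg_freq_def len
  proof (rule sum_mono)
    fix t assume t: "t \<in> {1..n}"
    show "freq I (maj I t) \<le> (if t \<le> 4 then 1 else 0) + 1 / real n"
    proof (cases "t \<le> 4")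
      case True
      have "freq I (maj I t) + 0 \<le> 1 + 1 / real n"
        by (intro add_mono freq_le_one) simp
      with True show ?thesis by simp
    next
      case False
      then have "maj I t = g t \<or> maj I t = g (t - 1)"
        using state[of t] t by auto
      with False show ?thesis
        using single[of t] single[of "t - 1"] by auto
    qed
  qed
  also have "\<dots> = real (card {t \<in> {1..n}. t \<le> 4}) + 1"
    using \<open>5 \<le> n\<close> by (simp add: sum.distrib flip: sum.inter_filter)
  also have "{t \<in> {1..n}. t \<le> 4} = {1..4}"
    using \<open>5 \<le> n\<close> by auto
  finally have maj: "agg_freq maj I \<le> 5" by simp

  have "eag I t = g 0" if "1 \<le> t" for t
    using eag_const[of I t] that it[of 1] it[of 2] \<open>5 \<le> n\<close> by (simp add: len h_def)
  then have "agg_freq eag I = real (card {i \<in> {1..n}. item I i = g 0})"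
    using \<open>5 \<le> n\<close> by (simp add: agg_freq_def freq_def len)
  \<comment> \<open>Counted here are the even positions other than 4. Parity costs at most another
    1/2, hence the term 3/2 below, and 5 + 3/2 is rounded up to 7.\<close>
  moreover have "n div 2 - 1 \<le> card {i \<in> {1..n}. item I i = g 0}"
  proof -
    have "card ((\<lambda>k. 2 * k) ` ({1..n div 2} - {2})) \<le> card {i \<in> {1..n}. item I i = g 0}"
      by (rule card_mono) (auto simp: it h_def)
    moreover have "card ((\<lambda>k. 2 * k) ` ({1..n div 2} - {2})) = card ({1..n div 2} - {2})"
      by (rule card_image) (simp add: inj_on_def)
    moreover have "card {1..n div 2} - 1 \<le> card ({1..n div 2} - {2})"
      using diff_card_le_card_Diff[of "{2}" "{1..n div 2}"] by simp
    ultimately show ?thesis by simp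
  qed
  ultimately have "real n / 2 - 3 / 2 \<le> agg_freq eag I"
    by linarith
  then show ?thesis using maj len by (intro exI[of _ I]) simp
qed

lemma diff_maj_eag_high:
  assumes "infinite (UNIV :: 'a set)" "5 \<le> n"
  shows "\<exists>I :: 'a list. length I = n \<and> real n - 8 \<le> agg_freq maj I - agg_freq eag I"
proof -
  obtain a b :: 'a where ab: "a \<noteq> b"
    using assms(1) by (metis UNIV_eq_I finite.emptyI finite_insert singleton_iff)
  define h where "h t = (if t \<le> 2 then b else a)" for t :: nat
  define I where "I = map h [1..<Suc n]"
  have len: "length I = n" by (simp add: I_def)
  have it: "item I t = h t" if "1 \<le> t" "t \<le> n" for t
    unfolding I_def using that by (rule item_map_upt)

  \<comment> \<open>The first two copies of \<open>a\<close> only undo the counter 2 of the initial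
    pair; the third one enters the buffer, and no other item arrives afterwards.\<close>
  have 5: "maj_state I 5 = (a, 1)"
  proof -
    have "maj_state I 1 = (b, 1)"
      using \<open>5 \<le> n\<close> by (simp add: maj_step_def it h_def)
    then have "maj_state I 2 = (b, 2)"
      using \<open>5 \<le> n\<close> by (simp add: maj_state_rec[of 2] maj_step_def it h_def)
    then have "maj_state I 3 = (b, 1)"
      using \<open>5 \<le> n\<close> ab by (simp add: maj_state_rec[of 3] maj_step_def it h_def)
    then have "maj_state I 4 = (b, 0)"
      using \<open>5 \<le> n\<close> ab by (simp add: maj_state_rec[of 4] maj_step_def it h_def)
    then show ?thesis
      using \<open>5 \<le> n\<close> by (simp add: maj_state_rec[of 5] maj_step_def it h_def)
  qed
  have state: "maj_state I t = (a, t - 4)" if "5 \<le> t" "t \<le> n" for t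
    using that
  proof (induction t rule: dec_induct)
    case (step t)
    then show ?case using it[of "Suc t"] by (simp add: h_def maj_step_def)
  qed (simp add: 5)
  have "{i \<in> {1..n}. item I i = a} = {3..n}"
    using ab by (auto simp: it h_def split: if_splits)
  then have fa: "freq I a = (real n - 2) / real n"
    using \<open>5 \<le> n\<close> by (simp add: freq_def len of_nat_diff)
  \<comment> \<open>The product is \<open>n - 6 + 8 / n\<close>. Eag gains exactly 2 in total, which
    yields \<open>n - 8\<close>.\<close>
  have "real n - 6 \<le> (real n - 4) * freq I a"
    using \<open>5 \<le> n\<close> by (simp add: fa field_simps)
  also have "\<dots> = (\<Sum>t = 5..n. freq I (maj I t))"
    using \<open>5 \<le> n\<close> state by (simp add: maj_def of_nat_diff)
  also have "\<dots> \<le> agg_freq maj I"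
    unfolding agg_freq_def len by (rule sum_mono2) (auto simp: freq_nonneg)
  finally have maj: "real n - 6 \<le> agg_freq maj I" .

  have "{i \<in> {1..n}. item I i = b} = {1..2}"
    using ab \<open>5 \<le> n\<close> by (auto simp: it h_def split: if_splits)
  then have "freq I b = 2 / real n"
    by (simp add: freq_def len)
  moreover have "eag I t = b" if "1 \<le> t" for t
    using eag_const[of I t] that it[of 1] it[of 2] \<open>5 \<le> n\<close> by (simp add: len h_def)
  ultimately have "agg_freq eag I = 2"
    using \<open>5 \<le> n\<close> by (simp add: agg_freq_def len)
  then show ?thesis using maj len by (intro exI[of _ I]) simp
qed


section \<open>Extrema at fixed length and their limits\<close>

lemma Min_at_ge:
  assumes "\<And>I. length I = n \<Longrightarrow> c \<le> agg_freq A I - agg_freq B I"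
  shows "c \<le> Min_at A B n"
  unfolding Min_at_def using assms
  by (subst Min_ge_iff[OF finite_diff_values diff_values_nonempty]) (auto simp: diff_values_def)

lemma Min_at_le:
  assumes "length I = n"
  shows "Min_at A B n \<le> agg_freq A I - agg_freq B I"
  unfolding Min_at_def using assms
  by (intro Min_le finite_diff_values) (auto simp: diff_values_def)

lemma Max_at_le:
  assumes "\<And>I. length I = n \<Longrightarrow> agg_freq A I - agg_freq B I \<le> c"
  shows "Max_at A B n \<le> c"
  unfolding Max_at_def using assms
  by (subst Max_le_iff[OF finite_diff_values diff_values_nonempty]) (auto simp: diff_values_def)

lemma Max_at_ge:
  assumes "length I = n"
  shows "agg_freq A I - agg_freq B I \<le> Max_at A B n"
  unfolding Max_at_def using assms
  by (intro Max_ge finite_diff_values) (auto simp: diff_values_def)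

lemma tendsto_add_const_divide_real:
  "(\<lambda>n. c + d / real n) \<longlonglongrightarrow> c"
  using tendsto_add[OF tendsto_const lim_const_over_n] by fastforce

theorem theorem7:
  assumes "infinite (UNIV :: 'a set)"
  shows "rel_interval (maj :: 'a algorithm) eag = {-1/2..1} \<and>
         Min_rel (maj :: 'a algorithm) eag = ereal (-1/2) \<and>
         Max_rel (maj :: 'a algorithm) eag = ereal 1"
proof -
  let ?min = "\<lambda>n. Min_at (maj :: 'a algorithm) eag n / real n"
  let ?max = "\<lambda>n. Max_at (maj :: 'a algorithm) eag n / real n"
  \<comment> \<open>The normalized extrema converge, so the limit inferior and the limit superior
    are read off from ordinary limits.\<close>
  have "?min \<longlonglongrightarrow> -1/2"
  proof (rule tendsto_sandwich)
    show "\<forall>\<^sub>F n in sequentially. -1/2 \<le> ?min n"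
    proof (rule eventually_sequentiallyI)
      fix n :: nat assume "1 \<le> n"
      have "- real n / 2 \<le> Min_at (maj :: 'a algorithm) eag n"
      proof (rule Min_at_ge)
        fix I :: "'a list" assume "length I = n"
        then show "- real n / 2 \<le> agg_freq maj I - agg_freq eag I"
          using agg_freq_diff_maj_le[of eag I] by simp
      qed
      with \<open>1 \<le> n\<close> show "-1/2 \<le> ?min n" by (simp add: field_simps)
    qed
    show "\<forall>\<^sub>F n in sequentially. ?min n \<le> -1/2 + 7 / real n"
    proof (rule eventually_sequentiallyI)
      fix n :: nat assume "5 \<le> n"
      then obtain I :: "'a list"
        where "length I = n" "agg_freq maj I - agg_freq eag I \<le> 7 - real n / 2"
        using diff_maj_eag_low[OF assms] by blast
      then have "Min_at (maj :: 'a algorithm) eag n \<le> 7 - real n / 2"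
        using Min_at_le[of I n maj eag] by simp
      with \<open>5 \<le> n\<close> show "?min n \<le> -1/2 + 7 / real n" by (simp add: field_simps)
    qed
  qed (rule tendsto_const tendsto_add_const_divide_real)+
  then have min: "Min_rel (maj :: 'a algorithm) eag = ereal (-1/2)"
    unfolding Min_rel_def by (intro lim_imp_Liminf tendsto_ereal) simp_all
  have "?max \<longlonglongrightarrow> 1"
  proof (rule tendsto_sandwich)
    show "\<forall>\<^sub>F n in sequentially. ?max n \<le> 1"
    proof (rule eventually_sequentiallyI)
      fix n :: nat assume "1 \<le> n"
      have "Max_at (maj :: 'a algorithm) eag n \<le> real n"
      proof (rule Max_at_le)
        fix I :: "'a list" assume "length I = n"
        then show "agg_freq maj I - agg_freq eag I \<le> real n"
          using agg_freq_le_length[of maj I] agg_freq_nonneg[of eag I] by simp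
      qed
      with \<open>1 \<le> n\<close> show "?max n \<le> 1" by simp
    qed
    show "\<forall>\<^sub>F n in sequentially. 1 + - 8 / real n \<le> ?max n"
    proof (rule eventually_sequentiallyI)
      fix n :: nat assume "5 \<le> n"
      then obtain I :: "'a list"
        where "length I = n" "real n - 8 \<le> agg_freq maj I - agg_freq eag I"
        using diff_maj_eag_high[OF assms] by blast
      then have "real n - 8 \<le> Max_at (maj :: 'a algorithm) eag n"
        using Max_at_ge[of I n maj eag] by simp
      then have "(real n - 8) / real n \<le> ?max n"
        by (rule divide_right_mono) simp
      with \<open>5 \<le> n\<close> show "1 + - 8 / real n \<le> ?max n" by (simp add: diff_divide_distrib)
    qed
  qed (rule tendsto_const tendsto_add_const_divide_real)+
  then have max: "Max_rel (maj :: 'a algorithm) eag = ereal 1"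
    unfolding Max_rel_def by (intro lim_imp_Limsup tendsto_ereal) simp_all
  have "rel_interval (maj :: 'a algorithm) eag = {-1/2..1}"
    unfolding rel_interval_def min max by auto
  with min max show ?thesis by blast
qed

end
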